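(* Let $X$ be a strongly regular graph with (distinct) eigenvalues $k,\theta,\tau$, where $k$ is the valency. (Odd case) If $k,\theta,\tau$ are odd integers with $k\equiv\theta\equiv\tau \pmod 4$, then for any pair of distinct non-adjacent vertices $u,v$ of $X$ there is a choice of real numbers $\beta,\gamma$ such that there is perfect state transfer between $u$ and $v$ in $X^{\beta,\gamma}_{u,v}$. (Even case) If $k,\theta,\tau$ are even integers with $k\equiv\theta\equiv\tau \pmod 4$, then for any pair of adjacent vertices $u,v$ of $X$ there is a choice of real numbers $\beta,\gamma$ such that there is perfect state transfer between $u$ and $v$ in $X^{\beta,\gamma}_{u,v}$.
   Context: A strongly regular graph with parameters $(n,k,a,c)$ is a graph on $n$ vertices, neither empty nor complete, in which every vertex has degree $k$, every two adjacent vertices have $a$ common neighbours, and every two distinct non-adjacent vertices have $c$ common neighbours. Throughout, strongly regular graphs are taken to have exactly three distinct adjacency eigenvalues $k,\theta,\tau$, with $k$ simple (equivalently, the graph is connected). For a graph $X$ with adjacency matrix $A$, distinct vertices $u,v$ and real $\beta,\gamma$, let $X^{\beta,\gamma}=X^{\beta,\gamma}_{u,v}$ be the weighted graph with adjacency matrix $A+H$, where $H=\beta(e_ue_v^T+e_ve_u^T)+\gamma(e_ue_u^T+e_ve_v^T)$ and $e_w$ denotes the standard basis vector indexed by $w$. For a (weighted) graph with real symmetric adjacency matrix $M$, let $U(t)=\exp(itM)$. There is perfect state transfer from $u$ to $v$ if $|U(t)_{u,v}|=1$ for some $t>0$. *)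

theory Defs
  imports "HOL-Analysis.Analysis" "HOL-Number_Theory.Cong"
begin

section \<open>Strongly regular graphs\<close>

text \<open>The vertex set of a graph is a finite type; the graph itself is its adjacency relation.\<close>

definition simple_graph :: "('n \<Rightarrow> 'n \<Rightarrow> bool) \<Rightarrow> bool" where
  "simple_graph E \<longleftrightarrow> symp E \<and> irreflp E"

definition strongly_regular ::
    "('n::finite \<Rightarrow> 'n \<Rightarrow> bool) \<Rightarrow> nat \<Rightarrow> nat \<Rightarrow> nat \<Rightarrow> nat \<Rightarrow> bool" where
  "strongly_regular E n k a c \<longleftrightarrow>
     simple_graph E \<and>
     CARD('n) = n \<and>
     (\<exists>x y. E x y) \<and>
     (\<exists>x y. x \<noteq> y \<and> \<not> E x y) \<and>
     (\<forall>x. card {z. E x z} = k) \<and>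
     (\<forall>x y. E x y \<longrightarrow> card {z. E x z \<and> E y z} = a) \<and>
     (\<forall>x y. x \<noteq> y \<and> \<not> E x y \<longrightarrow> card {z. E x z \<and> E y z} = c)"

definition adjacency_matrix :: "('n::finite \<Rightarrow> 'n \<Rightarrow> bool) \<Rightarrow> real^'n^'n" where
  "adjacency_matrix E = (\<chi> i j. if E i j then 1 else 0)"

definition eigenspace :: "real^'n^'n \<Rightarrow> real \<Rightarrow> (real^'n) set" where
  "eigenspace M l = {x. M *v x = l *\<^sub>R x}"

definition eigenvalues :: "real^'n^'n \<Rightarrow> real set" where
  "eigenvalues M = {l. \<exists>x \<in> eigenspace M l. x \<noteq> 0}"

text \<open>
  Adjacency matrices are symmetric, so real eigenvalues are all the eigenvalues, and an
  eigenvalue is simple iff its eigenspace has dimension one.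
\<close>

definition srg_eigenvalues ::
    "('n::finite \<Rightarrow> 'n \<Rightarrow> bool) \<Rightarrow> real \<Rightarrow> real \<Rightarrow> real \<Rightarrow> bool" where
  "srg_eigenvalues E k \<theta> \<tau> \<longleftrightarrow>
     distinct [k, \<theta>, \<tau>] \<and>
     eigenvalues (adjacency_matrix E) = {k, \<theta>, \<tau>} \<and>
     dim (eigenspace (adjacency_matrix E) k) = 1"


section \<open>Perturbation at a pair of vertices\<close>

definition outer_product :: "real^'n \<Rightarrow> real^'n \<Rightarrow> real^'n^'n" where
  "outer_product x y = (\<chi> i j. x $ i * y $ j)"

definition perturbation :: "real \<Rightarrow> real \<Rightarrow> 'n \<Rightarrow> 'n \<Rightarrow> real^'n^'n" where
  "perturbation \<beta> \<gamma> u v =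
     \<beta> *\<^sub>R (outer_product (axis u 1) (axis v 1) + outer_product (axis v 1) (axis u 1)) +
     \<gamma> *\<^sub>R (outer_product (axis u 1) (axis u 1) + outer_product (axis v 1) (axis v 1))"

definition perturbed_matrix ::
    "('n::finite \<Rightarrow> 'n \<Rightarrow> bool) \<Rightarrow> real \<Rightarrow> real \<Rightarrow> 'n \<Rightarrow> 'n \<Rightarrow> real^'n^'n" where
  "perturbed_matrix E \<beta> \<gamma> u v = adjacency_matrix E + perturbation \<beta> \<gamma> u v"


section \<open>Continuous quantum walks\<close>

text \<open>
  Multiplication \<^term>\<open>(*)\<close> and powers on the vector types are componentwise, hence the
  iterated matrix product.
\<close>

definition matrix_power :: "complex^'n^'n \<Rightarrow> nat \<Rightarrow> complex^'n^'n" where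
  "matrix_power A m = (((**) A) ^^ m) (mat 1)"

definition matrix_exp :: "complex^'n^'n \<Rightarrow> complex^'n^'n" where
  "matrix_exp A = (\<Sum>m. matrix_power A m /\<^sub>R fact m)"

definition transition_matrix :: "real^'n^'n \<Rightarrow> real \<Rightarrow> complex^'n^'n" where
  "transition_matrix M t = matrix_exp (\<chi> i j. \<i> * of_real t * of_real (M $ i $ j))"

definition perfect_state_transfer :: "real^'n^'n \<Rightarrow> 'n \<Rightarrow> 'n \<Rightarrow> bool" where
  "perfect_state_transfer M u v \<longleftrightarrow> (\<exists>t>0. cmod (transition_matrix M t $ u $ v) = 1)"

lemma norm_matrix_power_le:
  fixes A :: "complex^'n^'n"
  shows "norm (matrix_power A m $ i $ j) \<le> (\<Sum>i\<in>UNIV. \<Sum>j\<in>UNIV. norm (A $ i $ j)) ^ m"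
proof (induction m arbitrary: i j)
  case 0
  then show ?case by (simp add: matrix_power_def mat_def)
next
  case (Suc m)
  let ?K = "\<Sum>i\<in>UNIV. \<Sum>j\<in>UNIV. norm (A $ i $ j)"
  have "norm (matrix_power A (Suc m) $ i $ j)
      = norm (\<Sum>l\<in>UNIV. A $ i $ l * matrix_power A m $ l $ j)"
    by (simp add: matrix_power_def matrix_matrix_mult_def)
  also have "\<dots> \<le> (\<Sum>l\<in>UNIV. norm (A $ i $ l) * ?K ^ m)"
    by (rule sum_norm_le) (simp add: norm_mult mult_left_mono Suc.IH)
  also have "\<dots> = (\<Sum>l\<in>UNIV. norm (A $ i $ l)) * ?K ^ m"
    by (simp add: sum_distrib_right)
  also have "\<dots> \<le> ?K * ?K ^ m"
    by (intro mult_right_mono member_le_sum) (auto intro!: sum_nonneg zero_le_power)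
  finally show ?case by simp
qed

text \<open>The exponential series converges, so \<^const>\<open>matrix_exp\<close> is its actual sum.\<close>

lemma matrix_exp_sums:
  fixes A :: "complex^'n^'n"
  shows "(\<lambda>m. matrix_power A m /\<^sub>R fact m) sums matrix_exp A"
proof -
  let ?f = "\<lambda>m. matrix_power A m /\<^sub>R fact m"
  let ?K = "\<Sum>i\<in>UNIV. \<Sum>j\<in>UNIV. norm (A $ i $ j)"
  have entry: "summable (\<lambda>m. ?f m $ i $ j)" for i j
  proof (rule summable_comparison_test')
    show "summable (\<lambda>m. ?K ^ m /\<^sub>R fact m)" by (rule summable_exp_generic)
    show "norm (?f m $ i $ j) \<le> ?K ^ m /\<^sub>R fact m" for m
      using norm_matrix_power_le[of A m i j] by (simp add: mult_left_mono)
  qed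
  have "?f sums (\<chi> i j. \<Sum>m. ?f m $ i $ j)"
    unfolding sums_def
    by (intro vec_tendstoI)
      (use entry in \<open>simp add: sums_def[symmetric] summable_sums flip: scaleR_vec_def\<close>)
  then show ?thesis
    unfolding matrix_exp_def by (simp add: sums_iff)
qed

end

theory Submission
  imports Defs
begin

text \<open>
  Write \<open>A\<close> for the adjacency matrix and \<open>\<epsilon>\<close> for its entry at \<open>(u, v)\<close>.  Perturb with
  \<open>\<gamma> = - \<beta>\<close>.  The perturbation then kills every vector that takes the same value at \<open>u\<close> and \<open>v\<close>,
  and multiplies \<open>e\<^sub>u - e\<^sub>v\<close> by \<open>2\<gamma>\<close>.  In a strongly regular graph \<open>e\<^sub>u + e\<^sub>v\<close> and \<open>e\<^sub>u - e\<^sub>v\<close>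
  generate orthogonal \<open>A\<close>-invariant subspaces, because \<open>A\<^sup>2\<close> is a combination of \<open>I\<close>, \<open>A\<close> and the
  all-ones matrix; so both subspaces stay invariant under the perturbed matrix \<open>M\<close>, and they can be
  studied separately.

  On the subspace of \<open>e\<^sub>u + e\<^sub>v\<close> the matrices \<open>M\<close> and \<open>A\<close> agree, so the eigenvalues there are among
  \<open>k, \<theta>, \<tau>\<close>.  The subspace of \<open>e\<^sub>u - e\<^sub>v\<close> is at most two-dimensional, and the eigenvalues of
  \<open>M\<close> on it are the roots of a quadratic.  In the variable \<open>y = x - (\<theta> + \<tau> + \<epsilon>)\<close> its roots have
  product \<open>(\<theta> + \<epsilon>)(\<tau> + \<epsilon>)\<close>, whatever \<open>\<gamma>\<close> is, while their sum is moved freely by \<open>\<gamma>\<close>.  So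
  the roots can be taken to be \<open>\<sigma>\<close> and \<open>\<sigma>(\<theta> + \<epsilon>)(\<tau> + \<epsilon>)\<close> with a sign \<open>\<sigma>\<close> at our disposal.

  In both cases of the theorem \<open>\<theta> + \<epsilon>\<close> and \<open>\<tau> + \<epsilon>\<close> are odd and congruent modulo 4.  For the sign
  \<open>\<sigma>\<close> congruent to them, both new eigenvalues are congruent to \<open>k + 2\<close> modulo 4
  (\<open>sign_for_half_turn\<close>).  At time \<open>\<pi>/2\<close> an integer eigenvalue \<open>j\<close> contributes the phase \<open>\<i>\<^sup>j\<close>, so
  the walk multiplies \<open>e\<^sub>u + e\<^sub>v\<close> by \<open>\<i>\<^sup>k\<close> and \<open>e\<^sub>u - e\<^sub>v\<close> by \<open>- \<i>\<^sup>k\<close>; hence it sends \<open>e\<^sub>v\<close> to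
  \<open>\<i>\<^sup>k e\<^sub>u\<close>.
\<close>

section \<open>Matrix exponentials and eigenvectors\<close>

lemma matrix_power_eigenvector:
  fixes B :: "complex^'n^'n"
  assumes "B *v x = z *s x"
  shows "matrix_power B m *v x = z ^ m *s x"
proof (induction m)
  case 0
  then show ?case by (simp add: matrix_power_def)
next
  case (Suc m)
  have "matrix_power B (Suc m) *v x = B *v (matrix_power B m *v x)"
    by (simp add: matrix_power_def matrix_vector_mul_assoc)
  also have "\<dots> = z ^ Suc m *s x"
    by (simp add: Suc assms vector_scalar_commute vector_smult_assoc mult.commute)
  finally show ?case .
qed

lemma matrix_exp_eigenvector:
  fixes B :: "complex^'n^'n"
  assumes "B *v x = z *s x"
  shows "matrix_exp B *v x = exp z *s x"
proof (rule sums_unique2)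
  have "linear (\<lambda>A :: complex^'n^'n. A *v x)"
    by (rule linearI)
      (simp_all add: vec_eq_iff matrix_vector_mult_def scaleR_sum_right sum.distrib distrib_right)
  then have "bounded_linear (\<lambda>A :: complex^'n^'n. A *v x)"
    by (simp add: linear_conv_bounded_linear)
  from bounded_linear.sums[OF this matrix_exp_sums]
  show "(\<lambda>m. (matrix_power B m /\<^sub>R fact m) *v x) sums (matrix_exp B *v x)" .
  have "linear (\<lambda>w :: complex. w *s x)"
    by (rule linearI) (simp_all add: vec_eq_iff distrib_right)
  then have "bounded_linear (\<lambda>w :: complex. w *s x)"
    by (simp add: linear_conv_bounded_linear)
  from bounded_linear.sums[OF this exp_converges]
  have "(\<lambda>m. (z ^ m /\<^sub>R fact m) *s x) sums (exp z *s x)" .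
  moreover have "(matrix_power B m /\<^sub>R fact m) *v x = (z ^ m /\<^sub>R fact m) *s x" for m
  proof -
    have "(matrix_power B m /\<^sub>R fact m) *v x = (matrix_power B m *v x) /\<^sub>R fact m"
      by (simp add: vec_eq_iff matrix_vector_mult_def scaleR_sum_right)
    also have "\<dots> = (z ^ m /\<^sub>R fact m) *s x"
      by (simp add: matrix_power_eigenvector[OF assms] vec_eq_iff)
    finally show ?thesis .
  qed
  ultimately show "(\<lambda>m. (matrix_power B m /\<^sub>R fact m) *v x) sums (exp z *s x)"
    by simp
qed


section \<open>Vectors on which the walk acts by a phase\<close>

definition complex_vector :: "real^'n \<Rightarrow> complex^'n" where
  "complex_vector x = (\<chi> i. of_real (x $ i))"

text \<open>
  Working with the set of real vectors that the walk multiplies by \<open>w\<close> avoids a spectral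
  decomposition of \<open>M\<close>: it is a subspace containing every eigenvector of the right phase, so a
  vector lies in it as soon as it is a combination of such eigenvectors.
\<close>

definition phase_space :: "real^'n^'n \<Rightarrow> real \<Rightarrow> complex \<Rightarrow> (real^'n) set" where
  "phase_space M t w = {x. transition_matrix M t *v complex_vector x = w *s complex_vector x}"

lemma phase_space_diff:
  assumes "x \<in> phase_space M t w" and "y \<in> phase_space M t w"
  shows "x - y \<in> phase_space M t w"
proof -
  have "complex_vector (x - y) = complex_vector x - complex_vector y"
    by (simp add: complex_vector_def vec_eq_iff)
  with assms show ?thesis
    by (simp add: phase_space_def matrix_vector_mult_diff_distrib vector_ssub_ldistrib)
qed

lemma phase_space_scaleR:
  assumes "x \<in> phase_space M t w"
  shows "r *\<^sub>R x \<in> phase_space M t w"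
proof -
  have "complex_vector (r *\<^sub>R x) = of_real r *s complex_vector x"
    by (simp add: complex_vector_def vec_eq_iff)
  with assms show ?thesis
    by (simp add: phase_space_def vector_scalar_commute vector_smult_assoc mult.commute)
qed

lemma eigenvector_in_phase_space:
  fixes M :: "real^'n^'n"
  assumes "M *v x = \<mu> *\<^sub>R x" and "cis (t * \<mu>) = w"
  shows "x \<in> phase_space M t w"
proof -
  have "(\<Sum>j\<in>UNIV. M $ i $ j * x $ j) = \<mu> * x $ i" for i
    using assms(1) by (simp add: vec_eq_iff matrix_vector_mult_def)
  then have "(\<Sum>j\<in>UNIV. of_real (M $ i $ j) * of_real (x $ j)) = (of_real (\<mu> * x $ i) :: complex)"
    for i :: 'n
    by (metis (no_types, lifting) of_real_mult of_real_sum sum.cong)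
  then have "(\<chi> i j. \<i> * of_real t * of_real (M $ i $ j)) *v complex_vector x
      = (\<i> * of_real (t * \<mu>)) *s complex_vector x"
    by (simp add: vec_eq_iff matrix_vector_mult_def complex_vector_def mult.assoc
        flip: sum_distrib_left)
  from matrix_exp_eigenvector[OF this] assms(2) show ?thesis
    by (simp add: phase_space_def transition_matrix_def cis_conv_exp)
qed

definition shift :: "real^'n^'n \<Rightarrow> real \<Rightarrow> real^'n \<Rightarrow> real^'n" where
  "shift M \<mu> x = M *v x - \<mu> *\<^sub>R x"

lemma shift_commute: "shift M \<mu> (shift M \<nu> x) = shift M \<nu> (shift M \<mu> x)"
  by (simp add: shift_def matrix_vector_mult_diff_distrib scaleR_right_diff_distrib
      matrix_vector_mult_scaleR mult.commute)

text \<open>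
  \<open>x\<close> is a multiple of the difference of its two shifts.  Iterated, this is Lagrange interpolation:
  a vector annihilated by a product of distinct shifts is a sum of eigenvectors.
\<close>

lemma phase_space_from_shifts:
  assumes "shift M \<mu> x \<in> phase_space M t w" and "shift M \<nu> x \<in> phase_space M t w"
    and "\<mu> \<noteq> \<nu>"
  shows "x \<in> phase_space M t w"
proof -
  have "shift M \<nu> x - shift M \<mu> x = (\<mu> - \<nu>) *\<^sub>R x"
    by (simp add: shift_def scaleR_left_diff_distrib)
  then have "x = inverse (\<mu> - \<nu>) *\<^sub>R (shift M \<nu> x - shift M \<mu> x)"
    using assms(3) by simp
  then show ?thesis
    by (metis assms(1,2) phase_space_diff phase_space_scaleR)
qed

lemma phase_space_two_shifts:
  assumes "shift M \<mu> (shift M \<nu> x) = 0" and "\<mu> \<noteq> \<nu>"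
    and "cis (t * \<mu>) = w" and "cis (t * \<nu>) = w"
  shows "x \<in> phase_space M t w"
proof (rule phase_space_from_shifts)
  show "shift M \<nu> x \<in> phase_space M t w"
    by (rule eigenvector_in_phase_space[OF _ assms(3)]) (use assms(1) in \<open>simp add: shift_def\<close>)
  show "shift M \<mu> x \<in> phase_space M t w"
    by (rule eigenvector_in_phase_space[OF _ assms(4)])
      (use assms(1)[unfolded shift_commute[of M \<mu>]] in \<open>simp add: shift_def\<close>)
qed (use assms(2) in auto)

lemma phase_space_three_shifts:
  assumes "shift M \<mu> (shift M \<nu> (shift M \<rho> x)) = 0" and "distinct [\<mu>, \<nu>, \<rho>]"
    and "cis (t * \<mu>) = w" and "cis (t * \<nu>) = w" and "cis (t * \<rho>) = w"
  shows "x \<in> phase_space M t w"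
proof (rule phase_space_from_shifts)
  show "shift M \<rho> x \<in> phase_space M t w"
    by (rule phase_space_two_shifts[of M \<mu> \<nu>]) (use assms in auto)
  show "shift M \<nu> x \<in> phase_space M t w"
    by (rule phase_space_two_shifts[of M \<mu> \<rho>])
      (use assms in \<open>auto simp: shift_commute[of M \<rho> \<nu>]\<close>)
qed (use assms(2) in auto)

text \<open>
  Opposite phases on the sum and the difference of two basis vectors make the walk swap them, up
  to the phase \<open>w\<close>.
\<close>

lemma perfect_state_transfer_from_phases:
  fixes M :: "real^'n^'n"
  assumes "axis u 1 + axis v 1 \<in> phase_space M t w"
    and "axis u 1 - axis v 1 \<in> phase_space M t (- w)"
    and "t > 0" and "cmod w = 1"
  shows "perfect_state_transfer M u v"
proof -
  let ?U = "transition_matrix M t"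
  have plus: "complex_vector (axis u 1 + axis v 1) = axis u 1 + axis v 1"
    and minus: "complex_vector (axis u 1 - axis v 1) = axis u 1 - axis v 1"
    by (simp_all add: complex_vector_def vec_eq_iff axis_def)
  have "?U *v (axis u 1 + axis v 1) = w *s (axis u 1 + axis v 1)"
    using assms(1) unfolding phase_space_def mem_Collect_eq plus .
  moreover have "?U *v (axis u 1 - axis v 1) = (- w) *s (axis u 1 - axis v 1)"
    using assms(2) unfolding phase_space_def mem_Collect_eq minus .
  moreover have "axis v 1 + axis v 1 = (axis u 1 + axis v 1) - (axis u 1 - axis v 1 :: complex^'n)"
    by simp
  ultimately have "?U *v axis v 1 + ?U *v axis v 1
      = w *s (axis u 1 + axis v 1) - (- w) *s (axis u 1 - axis v 1)"
    by (metis matrix_vector_mult_diff_distrib matrix_vector_right_distrib)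
  also have "\<dots> = w *s axis u 1 + w *s axis u 1"
    by (simp add: vec_eq_iff algebra_simps)
  finally have "(?U *v axis v 1) $ u = w"
    by (simp add: vec_eq_iff flip: mult_2)
  then have "?U $ u $ v = w"
    by (simp add: matrix_vector_mult_def axis_def if_distrib cong: if_cong)
  with assms(3,4) show ?thesis
    unfolding perfect_state_transfer_def by blast
qed


section \<open>The quadratic identity of a strongly regular graph\<close>

text \<open>
  Entry \<open>(i, j)\<close> of the squared adjacency matrix counts the common neighbours of \<open>i\<close> and \<open>j\<close>.
\<close>

lemma adjacency_matrix_square:
  assumes "strongly_regular E n k a c"
  shows "adjacency_matrix E *v (adjacency_matrix E *v x)
    = (real k - real c) *\<^sub>R x + (real a - real c) *\<^sub>R (adjacency_matrix E *v x)
      + (real c * (\<Sum>i\<in>UNIV. x $ i)) *\<^sub>R 1"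
proof -
  let ?A = "adjacency_matrix E"
  have sym: "E i j \<longleftrightarrow> E j i" and irr: "\<not> E i i" for i j
    using assms by (auto simp: strongly_regular_def simple_graph_def symp_def irreflp_def)
  have entry: "(?A ** ?A) $ i $ j
      = (real k - real c) * mat 1 $ i $ j + (real a - real c) * ?A $ i $ j + real c" for i j
  proof -
    have "(?A ** ?A) $ i $ j = (\<Sum>l\<in>UNIV. if E i l \<and> E j l then 1 else 0)"
      unfolding matrix_matrix_mult_def adjacency_matrix_def
      by (simp, intro sum.cong) (auto simp: sym)
    also have "\<dots> = real (card {l. E i l \<and> E j l})"
      by (simp add: sum.If_cases)
    finally show ?thesis
      using assms irr by (auto simp: strongly_regular_def mat_def adjacency_matrix_def)
  qed
  have "?A *v (?A *v x) = (?A ** ?A) *v x"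
    by (simp add: matrix_vector_mul_assoc)
  also have "\<dots> = (real k - real c) *\<^sub>R (mat 1 *v x) + (real a - real c) *\<^sub>R (?A *v x)
      + (real c * (\<Sum>i\<in>UNIV. x $ i)) *\<^sub>R 1"
    by (simp add: vec_eq_iff matrix_vector_mult_def entry sum.distrib distrib_right
        sum_distrib_left mult.assoc)
  finally show ?thesis by simp
qed

lemma adjacency_matrix_one:
  assumes "strongly_regular E n k a c"
  shows "adjacency_matrix E *v 1 = real k *\<^sub>R 1"
  using assms
  by (simp add: vec_eq_iff matrix_vector_mult_def adjacency_matrix_def strongly_regular_def
      sum.If_cases)

lemma sum_adjacency_matrix_mult:
  assumes "strongly_regular E n k a c"
  shows "(\<Sum>i\<in>UNIV. (adjacency_matrix E *v x) $ i) = real k * (\<Sum>i\<in>UNIV. x $ i)"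
proof -
  let ?A = "adjacency_matrix E"
  have column: "(\<Sum>i\<in>UNIV. ?A $ i $ j) = real k" for j
  proof -
    have "E i j \<longleftrightarrow> E j i" for i
      using assms by (auto simp: strongly_regular_def simple_graph_def symp_def)
    then show ?thesis
      using assms by (simp add: adjacency_matrix_def strongly_regular_def sum.If_cases)
  qed
  have "(\<Sum>i\<in>UNIV. (?A *v x) $ i) = (\<Sum>j\<in>UNIV. \<Sum>i\<in>UNIV. ?A $ i $ j * x $ j)"
    unfolding matrix_vector_mult_def by (simp, rule sum.swap)
  also have "\<dots> = real k * (\<Sum>j\<in>UNIV. x $ j)"
    by (simp add: column sum_distrib_left flip: sum_distrib_right)
  finally show ?thesis .
qed

text \<open>
  An eigenvector for \<open>l \<noteq> k\<close> is orthogonal to the all-ones vector, so the last term of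
  \<open>adjacency_matrix_square\<close> vanishes on it.
\<close>

lemma srg_eigenvalue_quadratic:
  assumes srg: "strongly_regular E n k a c"
    and "l \<in> eigenvalues (adjacency_matrix E)" and "l \<noteq> real k"
  shows "l ^ 2 = (real k - real c) + (real a - real c) * l"
proof -
  let ?A = "adjacency_matrix E"
  obtain x where x: "?A *v x = l *\<^sub>R x" "x \<noteq> 0"
    using assms(2) by (auto simp: eigenvalues_def eigenspace_def)
  have "l * (\<Sum>i\<in>UNIV. x $ i) = real k * (\<Sum>i\<in>UNIV. x $ i)"
    using sum_adjacency_matrix_mult[OF srg, of x] by (simp add: x(1) sum_distrib_left)
  then have "(\<Sum>i\<in>UNIV. x $ i) = 0"
    using assms(3) by simp
  with adjacency_matrix_square[OF srg, of x]
  have "(l ^ 2 - (real k - real c) - (real a - real c) * l) *\<^sub>R x = 0"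
    by (simp add: x(1) matrix_vector_mult_scaleR algebra_simps power2_eq_square)
  with x(2) show ?thesis by simp
qed

lemma srg_eigenvalues_Vieta:
  assumes srg: "strongly_regular E n k a c" and "srg_eigenvalues E (real k) \<theta> \<tau>"
  shows "real a - real c = \<theta> + \<tau>" and "real k - real c = - \<theta> * \<tau>"
proof -
  have neq: "\<theta> \<noteq> \<tau>" "\<theta> \<noteq> real k" "\<tau> \<noteq> real k"
    and "\<theta> \<in> eigenvalues (adjacency_matrix E)" "\<tau> \<in> eigenvalues (adjacency_matrix E)"
    using assms(2) by (auto simp: srg_eigenvalues_def)
  then have quad: "\<theta> ^ 2 = (real k - real c) + (real a - real c) * \<theta>"
      "\<tau> ^ 2 = (real k - real c) + (real a - real c) * \<tau>"
    using srg_eigenvalue_quadratic[OF srg] by blast+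
  then have "(\<theta> - \<tau>) * (\<theta> + \<tau> - (real a - real c)) = 0"
    by (simp add: algebra_simps power2_eq_square)
  with neq show sum: "real a - real c = \<theta> + \<tau>" by simp
  show "real k - real c = - \<theta> * \<tau>"
    using quad(1) unfolding sum by (simp add: algebra_simps power2_eq_square)
qed


section \<open>The perturbed matrix\<close>

text \<open>
  For \<open>\<beta> = - \<gamma>\<close> the perturbation has rank at most one, and it does not see vectors with equal entries at
  \<open>u\<close> and \<open>v\<close>.
\<close>

lemma perturbation_antisymmetric_mult:
  fixes u v :: "'n::finite"
  shows
  "perturbation (- g) g u v *v x = (g * (x $ u - x $ v)) *\<^sub>R (axis u 1 - axis v 1)"
proof -
  have outer: "outer_product y z *v x = (z \<bullet> x) *\<^sub>R y" for y z :: "real^'n"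
    by (simp add: vec_eq_iff outer_product_def matrix_vector_mult_def inner_vec_def
        sum_distrib_left mult_ac)
  show ?thesis
    by (simp add: perturbation_def matrix_vector_mult_add_rdistrib scaleR_matrix_vector_assoc[symmetric]
        outer inner_axis' algebra_simps)
qed

lemma perturbed_matrix_mult:
  "perturbed_matrix E (- g) g u v *v x
    = adjacency_matrix E *v x + (g * (x $ u - x $ v)) *\<^sub>R (axis u 1 - axis v 1)"
  by (simp add: perturbed_matrix_def matrix_vector_mult_add_rdistrib perturbation_antisymmetric_mult)

lemma adjacency_matrix_axis: "(adjacency_matrix E *v axis v 1) $ i = (if E i v then 1 else 0)"
  by (simp add: matrix_vector_mult_basis column_def adjacency_matrix_def)

lemma sum_axis: "(\<Sum>i\<in>UNIV. axis v (1::real) $ i) = 1"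
  by (simp add: axis_def sum.If_cases)

text \<open>
  All vectors met while applying the shifts have equal entries at \<open>u\<close> and \<open>v\<close>: for \<open>e\<^sub>u + e\<^sub>v\<close> and
  its image under \<open>A\<close> this is the symmetry of \<open>A\<close> and its zero diagonal, and the next vector is
  already constant.  Hence the perturbation is never felt, and the claim is the
  identity \<open>(A - k)(A - \<theta>)(A - \<tau>) = 0\<close>.
\<close>

lemma symmetric_vector_annihilated:
  fixes u v :: "'n::finite" and g :: real
  assumes srg: "strongly_regular E n k a c" and eig: "srg_eigenvalues E (real k) \<theta> \<tau>"
  defines "M \<equiv> perturbed_matrix E (- g) g u v"
  shows "shift M (real k) (shift M \<theta> (shift M \<tau> (axis u 1 + axis v 1))) = 0"
proof -
  let ?A = "adjacency_matrix E" and ?x = "axis u 1 + axis v 1 :: real^'n"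
  note Vieta = srg_eigenvalues_Vieta[OF srg eig]
  have sym: "E i j \<longleftrightarrow> E j i" and irr: "\<not> E i i" for i j
    using srg by (auto simp: strongly_regular_def simple_graph_def symp_def irreflp_def)
  have shift_M: "shift M l y = ?A *v y - l *\<^sub>R y" if "y $ u = y $ v" for l y
    using that by (simp add: M_def shift_def perturbed_matrix_mult)
  have x: "?x $ u = ?x $ v"
    by (simp add: axis_def)
  have Ax: "(?A *v ?x) $ u = (?A *v ?x) $ v"
    using sym[of u v] irr by (simp add: matrix_vector_right_distrib adjacency_matrix_axis)
  have "shift M \<theta> (shift M \<tau> ?x) = shift M \<theta> (?A *v ?x - \<tau> *\<^sub>R ?x)"
    by (simp only: shift_M[OF x])
  also have "\<dots> = ?A *v (?A *v ?x - \<tau> *\<^sub>R ?x) - \<theta> *\<^sub>R (?A *v ?x - \<tau> *\<^sub>R ?x)"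
    by (rule shift_M) (use x Ax in simp)
  also have "\<dots> = ?A *v (?A *v ?x) - (\<theta> + \<tau>) *\<^sub>R (?A *v ?x) + (\<theta> * \<tau>) *\<^sub>R ?x"
    unfolding matrix_vector_mult_diff_distrib matrix_vector_mult_scaleR
    by (simp add: vec_eq_iff algebra_simps)
  also have "\<dots> = (real c * (\<Sum>i\<in>UNIV. ?x $ i)) *\<^sub>R 1"
    unfolding adjacency_matrix_square[OF srg] Vieta
    by (simp add: vec_eq_iff algebra_simps)
  finally have "shift M \<theta> (shift M \<tau> ?x) = (real c * (\<Sum>i\<in>UNIV. ?x $ i)) *\<^sub>R 1" .
  then show ?thesis
    by (simp add: shift_M matrix_vector_mult_scaleR adjacency_matrix_one[OF srg])
qed

text \<open>
  If \<open>e\<^sub>u - e\<^sub>v\<close> and \<open>A(e\<^sub>u - e\<^sub>v)\<close> are independent, then on their span \<open>M\<close> has trace \<open>\<theta> + \<tau> + 2g\<close> and determinant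
  \<open>\<theta>\<tau> + 2g(\<theta> + \<tau> + \<epsilon>)\<close>.  After translating the eigenvalues by \<open>\<theta> + \<tau> + \<epsilon>\<close>, their
  product no longer involves \<open>g\<close>; so one can prescribe two numbers \<open>y1\<close>, \<open>y2\<close> with the right product
  and choose \<open>g\<close> to fit their sum.
\<close>

lemma antisymmetric_vector_annihilated:
  fixes u v :: "'n::finite" and y1 y2 g :: real
  assumes srg: "strongly_regular E n k a c" and eig: "srg_eigenvalues E (real k) \<theta> \<tau>"
    and "u \<noteq> v"
  defines "\<epsilon> \<equiv> (if E u v then 1 else 0)"
  assumes "y1 * y2 = (\<theta> + \<epsilon>) * (\<tau> + \<epsilon>)" and "2 * g = \<theta> + \<tau> + 2 * \<epsilon> + y1 + y2"
  defines "M \<equiv> perturbed_matrix E (- g) g u v"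
  shows "shift M (\<theta> + \<tau> + \<epsilon> + y1) (shift M (\<theta> + \<tau> + \<epsilon> + y2) (axis u 1 - axis v 1)) = 0"
proof -
  let ?A = "adjacency_matrix E"
  define x :: "real^'n" where "x = axis u 1 - axis v 1"
  note Vieta = srg_eigenvalues_Vieta[OF srg eig]
  have sym: "E i j \<longleftrightarrow> E j i" and irr: "\<not> E i i" for i j
    using srg by (auto simp: strongly_regular_def simple_graph_def symp_def irreflp_def)
  have "x $ u - x $ v = 2"
    using \<open>u \<noteq> v\<close> by (simp add: x_def axis_def)
  then have Mx: "M *v x = ?A *v x + (2 * g) *\<^sub>R x"
    unfolding M_def perturbed_matrix_mult by (simp add: mult.commute flip: x_def)
  have "(?A *v x) $ u - (?A *v x) $ v = - 2 * \<epsilon>"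
    using sym[of u v] irr
    by (simp add: matrix_vector_mult_diff_distrib adjacency_matrix_axis x_def \<epsilon>_def)
  then have "M *v (?A *v x) = ?A *v (?A *v x) - (2 * g * \<epsilon>) *\<^sub>R x"
    unfolding M_def perturbed_matrix_mult by (simp add: mult_ac flip: x_def)
  moreover have "(\<Sum>i\<in>UNIV. x $ i) = 0"
    by (simp add: x_def sum_subtractf sum_axis)
  ultimately have MAx: "M *v (?A *v x) = (\<theta> + \<tau>) *\<^sub>R (?A *v x) - (\<theta> * \<tau> + 2 * g * \<epsilon>) *\<^sub>R x"
    unfolding adjacency_matrix_square[OF srg] Vieta
    by (simp add: vec_eq_iff algebra_simps)
  define r s where "r = \<theta> + \<tau> + \<epsilon> + y1" and "s = \<theta> + \<tau> + \<epsilon> + y2"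
  have "shift M r (shift M s x) = (\<theta> + \<tau> + 2 * g - r - s) *\<^sub>R (?A *v x)
      + ((2 * g - r) * (2 * g - s) - \<theta> * \<tau> - 2 * g * \<epsilon>) *\<^sub>R x"
    unfolding shift_def matrix_vector_mult_diff_distrib matrix_vector_mult_scaleR
      Mx matrix_vector_right_distrib MAx
    by (simp add: vec_eq_iff algebra_simps)
  moreover have "\<theta> + \<tau> + 2 * g - r - s = 0"
    using assms(6) by (simp add: r_def s_def)
  moreover have "(2 * g - r) * (2 * g - s) - \<theta> * \<tau> - 2 * g * \<epsilon> = 0"
    using assms(5) unfolding assms(6) r_def s_def by (simp add: algebra_simps)
  ultimately show ?thesis
    by (simp add: r_def s_def x_def)
qed


section \<open>Choosing the eigenvalues modulo 4\<close>

lemma cis_quarter_turns_cong: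
  assumes "[i = j] (mod 4)"
  shows "cis (pi / 2 * of_int i) = cis (pi / 2 * of_int j)"
proof -
  obtain m where "i = j + 4 * m"
    using assms by (metis cong_iff_lin cong_sym)
  then have "cis (pi / 2 * of_int i) = cis (pi / 2 * of_int j) * cis (2 * pi * of_int m)"
    by (simp add: cis_mult algebra_simps)
  then show ?thesis
    by (simp add: cis_multiple_2pi)
qed

lemma cis_quarter_turns_half:
  assumes "[i = j + 2] (mod 4)"
  shows "cis (pi / 2 * of_int i) = - cis (pi / 2 * of_int j)"
proof -
  have "cis (pi / 2 * of_int i) = cis (pi / 2 * of_int j + pi)"
    unfolding cis_quarter_turns_cong[OF assms] by (simp add: algebra_simps)
  then show ?thesis
    by (simp flip: cis_mult)
qed

text \<open>
  Put \<open>\<sigma>\<close> congruent to the odd numbers \<open>p + e\<close> and \<open>q + e\<close>.  Then \<open>q + e + \<sigma>\<close> is \<open>2\<sigma>\<close>, that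
  is 2, modulo 4, and replacing \<open>\<sigma>\<close> by \<open>\<sigma>(p + e)(q + e)\<close> changes nothing, since the extra factor is
  congruent to \<open>\<sigma>\<^sup>2 = 1\<close>.
\<close>

lemma sign_for_half_turn:
  fixes p q e :: int
  assumes "[p = q] (mod 4)" and "odd (p + e)"
  obtains \<sigma> where "\<sigma> = 1 \<or> \<sigma> = - 1"
    and "[p + q + e + \<sigma> = p + 2] (mod 4)"
    and "[p + q + e + \<sigma> * ((p + e) * (q + e)) = p + 2] (mod 4)"
proof -
  obtain \<sigma> :: int where \<sigma>: "\<sigma> = 1 \<or> \<sigma> = - 1" "[p + e = \<sigma>] (mod 4)"
  proof (cases "(p + e) mod 4 = 1")
    case True
    then show ?thesis by (intro that[of 1]) (simp_all add: cong_def)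
  next
    case False
    then have "(p + e) mod 4 = 3" using assms(2) by presburger
    then show ?thesis by (intro that[of "- 1"]) (simp_all add: cong_def)
  qed
  have q: "[q + e = \<sigma>] (mod 4)"
    by (rule cong_trans[OF cong_add[OF cong_sym[OF assms(1)] cong_refl] \<sigma>(2)])
  have square: "\<sigma> * \<sigma> = 1" and "[2 * \<sigma> = 2] (mod 4)"
    using \<sigma>(1) by (auto simp: cong_def)
  have "[p + (q + e) + \<sigma> = p + \<sigma> + \<sigma>] (mod 4)"
    by (intro cong_add cong_refl q)
  moreover have "[p + 2 * \<sigma> = p + 2] (mod 4)"
    by (intro cong_add cong_refl) fact
  ultimately have first: "[p + q + e + \<sigma> = p + 2] (mod 4)"
    by (metis add.assoc cong_trans mult_2)
  have "[\<sigma> * ((p + e) * (q + e)) = \<sigma> * (\<sigma> * \<sigma>)] (mod 4)"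
    by (intro cong_mult cong_refl q \<sigma>(2))
  then have "[p + q + e + \<sigma> * ((p + e) * (q + e)) = p + q + e + \<sigma>] (mod 4)"
    unfolding square by (intro cong_add cong_refl) simp
  from \<sigma>(1) first cong_trans[OF this first] show ?thesis
    by (rule that)
qed

text \<open>
  The odd case for non-adjacent and the even case for adjacent vertices are the same statement: the
  common parity of the eigenvalues enters only through \<open>p\<close> plus the entry of the adjacency matrix
  at \<open>(u, v)\<close> being odd.
\<close>

lemma perfect_state_transfer_perturbed:
  fixes p q :: int and u v :: "'n::finite"
  assumes srg: "strongly_regular E n k a c"
    and eig: "srg_eigenvalues E (real k) (of_int p) (of_int q)"
    and kp: "[int k = p] (mod 4)" and pq: "[p = q] (mod 4)"
    and uv: "u \<noteq> v" and parity: "odd (p + (if E u v then 1 else 0))"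
  shows "\<exists>\<beta> \<gamma>. perfect_state_transfer (perturbed_matrix E \<beta> \<gamma> u v) u v"
proof -
  define e :: int where "e = (if E u v then 1 else 0)"
  have e: "(if E u v then 1 else 0) = (of_int e :: real)"
    by (simp add: e_def)
  obtain \<sigma> where \<sigma>: "\<sigma> = 1 \<or> \<sigma> = - 1"
      "[p + q + e + \<sigma> = p + 2] (mod 4)"
      "[p + q + e + \<sigma> * ((p + e) * (q + e)) = p + 2] (mod 4)"
    using sign_for_half_turn[OF pq parity] unfolding e_def by blast
  define y where "y = \<sigma> * ((p + e) * (q + e))"
  define g :: real where "g = of_int (p + q + 2 * e + \<sigma> + y) / 2"
  define M where "M = perturbed_matrix E (- g) g u v"
  have distinct: "distinct [real k, of_int p, of_int q]"
    using eig by (simp add: srg_eigenvalues_def)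
  have "axis u 1 + axis v 1 \<in> phase_space M (pi / 2) (cis (pi / 2 * of_int p))"
  proof (rule phase_space_three_shifts)
    show "shift M (real k) (shift M (of_int p) (shift M (of_int q) (axis u 1 + axis v 1))) = 0"
      unfolding M_def by (rule symmetric_vector_annihilated[OF srg eig])
    show "cis (pi / 2 * real k) = cis (pi / 2 * of_int p)"
      using cis_quarter_turns_cong[OF kp] by simp
    show "cis (pi / 2 * of_int q) = cis (pi / 2 * of_int p)"
      by (rule cis_quarter_turns_cong[OF cong_sym[OF pq]])
  qed (simp_all only: distinct)
  moreover have "axis u 1 - axis v 1 \<in> phase_space M (pi / 2) (- cis (pi / 2 * of_int p))"
  proof (rule phase_space_two_shifts)
    show "shift M (of_int (p + q + e + \<sigma>)) (shift M (of_int (p + q + e + y))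
        (axis u 1 - axis v 1)) = 0"
    proof -
      have "\<sigma> * y = (p + e) * (q + e)"
        using \<sigma>(1) by (auto simp: y_def)
      then have "of_int \<sigma> * of_int y = (of_int p + of_int e) * (of_int q + of_int e :: real)"
        by (metis of_int_add of_int_mult)
      moreover have "2 * g = of_int p + of_int q + 2 * of_int e + of_int \<sigma> + of_int y"
        by (simp add: g_def)
      ultimately show ?thesis
        using antisymmetric_vector_annihilated[OF srg eig uv, of "of_int \<sigma>" "of_int y" g]
        unfolding e M_def by simp
    qed
    show "of_int (p + q + e + \<sigma>) \<noteq> (of_int (p + q + e + y) :: real)"
    proof
      assume "of_int (p + q + e + \<sigma>) = (of_int (p + q + e + y) :: real)"
      then have "\<sigma> = y"
        by linarith
      \<comment> \<open>The two translated eigenvalues coincide only if \<open>p + e\<close> and \<open>q + e\<close> are the same unit, but \<open>p \<noteq> q\<close>.\<close>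
      then have "(p + e) * (q + e) = 1"
        using \<sigma>(1) by (auto simp: y_def)
      then have "p + e = q + e"
        by (metis zmult_eq_1_iff)
      with distinct show False
        by simp
    qed
  qed (use \<sigma>(2,3) in \<open>simp_all only: y_def cis_quarter_turns_half\<close>)
  ultimately have "perfect_state_transfer M u v"
    by (rule perfect_state_transfer_from_phases) simp_all
  then show ?thesis
    unfolding M_def by blast
qed

theorem theorem1:
  fixes E :: "'n::finite \<Rightarrow> 'n \<Rightarrow> bool"
    and n k a c :: nat
    and \<theta> \<tau> :: real
  assumes "strongly_regular E n k a c"
    and "srg_eigenvalues E (real k) \<theta> \<tau>"
  shows "(\<forall>p q :: int.
            \<theta> = of_int p \<and> \<tau> = of_int q \<and>
            odd k \<and> odd p \<and> odd q \<and>
            [int k = p] (mod 4) \<and> [p = q] (mod 4) \<longrightarrow>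
            (\<forall>u v. u \<noteq> v \<and> \<not> E u v \<longrightarrow>
               (\<exists>\<beta> \<gamma> :: real. perfect_state_transfer (perturbed_matrix E \<beta> \<gamma> u v) u v)))
       \<and> (\<forall>p q :: int.
            \<theta> = of_int p \<and> \<tau> = of_int q \<and>
            even k \<and> even p \<and> even q \<and>
            [int k = p] (mod 4) \<and> [p = q] (mod 4) \<longrightarrow>
            (\<forall>u v. E u v \<longrightarrow>
               (\<exists>\<beta> \<gamma> :: real. perfect_state_transfer (perturbed_matrix E \<beta> \<gamma> u v) u v)))"
proof (intro conjI allI impI; elim conjE)
  fix p q :: int and u v
  assume "\<theta> = of_int p" "\<tau> = of_int q" "odd p" "[int k = p] (mod 4)" "[p = q] (mod 4)"
    and "u \<noteq> v" "\<not> E u v"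
  then show "\<exists>\<beta> \<gamma>. perfect_state_transfer (perturbed_matrix E \<beta> \<gamma> u v) u v"
    using assms by (intro perfect_state_transfer_perturbed[of E n k a c p q]) simp_all
next
  fix p q :: int and u v
  assume "\<theta> = of_int p" "\<tau> = of_int q" "even p" "[int k = p] (mod 4)" "[p = q] (mod 4)"
    and "E u v"
  moreover from \<open>E u v\<close> have "u \<noteq> v"
    using assms(1) by (auto simp: strongly_regular_def simple_graph_def irreflp_def)
  ultimately show "\<exists>\<beta> \<gamma>. perfect_state_transfer (perturbed_matrix E \<beta> \<gamma> u v) u v"
    using assms by (intro perfect_state_transfer_perturbed[of E n k a c p q]) simp_all
qed

end
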